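(* Let $\Sigma$ be an entire spacelike hypersurface in $\mathbb R^{n,1}$ with null support function $\varphi:\mathbb S^{n-1}\to\mathbb R\cup\{+\infty\}$. Then the asymptotic cut of $\Sigma$ at future null infinity is the graph of $-\varphi$; that is, the function $\psi$ defining the asymptotic cut satisfies $\psi(\theta)=-\varphi(\theta)$ for all $\theta\in\mathbb S^{n-1}$.
   Context: Minkowski space $\mathbb R^{n,1}$ ($n\ge 1$) is $\mathbb R^{n+1}$ with $dx_1^2+\dots+dx_n^2-dx_{n+1}^2$. A spacelike hypersurface is a smooth connected hypersurface on which the induced metric is Riemannian; it is entire if it is the graph $\{x_{n+1}=u(\mathbf x)\}$ of a function $u:\mathbb R^n\to\mathbb R$. Its null support function is $\varphi(\theta)=\sup_{\mathbf y\in\mathbb R^n}\big(\theta\cdot\mathbf y-u(\mathbf y)\big)$ for $\theta\in\mathbb S^{n-1}$. On the complement of the $x_{n+1}$-axis use coordinates $(t',t_a,\theta)$: if $(r,\theta)$, $r>0$, $\theta\in\mathbb S^{n-1}$, are spherical coordinates on $\mathbb R^n$, then $t'=x_{n+1}-r$ and $t_a=x_{n+1}+r$. Fixing $\theta$ defines a half-plane, which meets $\Sigma$ along a spacelike curve; for $t_a$ large enough this curve is the graph of a decreasing function $t'=f_\theta(t_a)$. The asymptotic cut of $\Sigma$ at future null infinity is the graph of the upper semicontinuous function $\psi(\theta)=\lim_{t_a\to+\infty}f_\theta(t_a)$ on $\mathbb S^{n-1}$, with values in $\mathbb R\cup\{-\infty\}$.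
   Formalization: Along some rays t_a stays bounded on Σ (e.g. u = −√(1+|x|²), where t_a < 0), so f_θ(t_a) is undefined for large t_a and so is the limit ψ; here f_θ(t_a) is set to −∞ wherever the curve does not attain t_a, and no hypersurface is excluded. *)

theory Defs
  imports "HOL-Analysis.Analysis"
begin

text \<open>Minkowski space of signature (n,1) is modelled as \<^typ>\<open>(real ^ 'n) \<times> real\<close>, where n is the
  cardinality of the index type; the second component is the time coordinate.\<close>

type_synonym 'n minkowski = "(real ^ 'n) \<times> real"

definition mink_inner :: "'n::finite minkowski \<Rightarrow> 'n minkowski \<Rightarrow> real" where
  "mink_inner v w = fst v \<bullet> fst w - snd v * snd w"

text \<open>Only used on open sets, where the derivative \<open>at x\<close> depends on the values of the function
  near \<open>x\<close> only. In finite dimension, continuity of all directional derivatives of order at most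
  \<open>k\<close> is the usual notion of class \<open>C\<close>-\<open>k\<close>.\<close>

primrec Ck_on :: "nat \<Rightarrow> ('a::euclidean_space \<Rightarrow> 'b::real_normed_vector) \<Rightarrow> 'a set \<Rightarrow> bool" where
  "Ck_on 0 f U \<longleftrightarrow> continuous_on U f"
| "Ck_on (Suc k) f U \<longleftrightarrow>
     (\<forall>x\<in>U. f differentiable (at x)) \<and> (\<forall>v. Ck_on k (\<lambda>x. frechet_derivative f (at x) v) U)"

definition smooth_on :: "('a::euclidean_space \<Rightarrow> 'b::real_normed_vector) \<Rightarrow> 'a set \<Rightarrow> bool" where
  "smooth_on f U \<longleftrightarrow> (\<forall>k. Ck_on k f U)"

text \<open>\<open>F\<close> presents \<open>S\<close> as a regular level set on the open neighbourhood \<open>U\<close> of \<open>p\<close>.\<close>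

definition local_defining_function ::
  "'a::euclidean_space set \<Rightarrow> 'a \<Rightarrow> 'a set \<Rightarrow> ('a \<Rightarrow> real) \<Rightarrow> bool" where
  "local_defining_function S p U F \<longleftrightarrow>
     open U \<and> p \<in> U \<and> smooth_on F U \<and> S \<inter> U = {x \<in> U. F x = 0} \<and>
     (\<forall>x \<in> S \<inter> U. \<exists>v. frechet_derivative F (at x) v \<noteq> 0)"

definition smooth_hypersurface :: "'a::euclidean_space set \<Rightarrow> bool" where
  "smooth_hypersurface S \<longleftrightarrow> (\<forall>p\<in>S. \<exists>U F. local_defining_function S p U F)"

text \<open>The tangent space is the kernel of the derivative of a local defining function; this kernel
  does not depend on the choice of that function.\<close>

definition tangent_space :: "'a::euclidean_space set \<Rightarrow> 'a \<Rightarrow> 'a set" where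
  "tangent_space S p =
     {v. \<exists>U F. local_defining_function S p U F \<and> frechet_derivative F (at p) v = 0}"

definition spacelike_hypersurface :: "'n::finite minkowski set \<Rightarrow> bool" where
  "spacelike_hypersurface S \<longleftrightarrow>
     smooth_hypersurface S \<and> connected S \<and>
     (\<forall>p\<in>S. \<forall>v\<in>tangent_space S p. v \<noteq> 0 \<longrightarrow> mink_inner v v > 0)"

definition graph_of :: "(real ^ 'n \<Rightarrow> real) \<Rightarrow> 'n::finite minkowski set" where
  "graph_of u = {(x, u x) | x. True}"

definition null_support :: "(real ^ 'n::finite \<Rightarrow> real) \<Rightarrow> real ^ 'n \<Rightarrow> ereal" where
  "null_support u \<theta> = (SUP y. ereal (\<theta> \<bullet> y - u y))"

text \<open>The point with coordinates \<open>(t', ta, \<theta>)\<close>, where \<open>t' = x\<^sub>n\<^sub>+\<^sub>1 - r\<close> and \<open>ta = x\<^sub>n\<^sub>+\<^sub>1 + r\<close>; the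
  condition \<open>r > 0\<close> reads \<open>t' < ta\<close>.\<close>

definition null_point :: "real ^ 'n::finite \<Rightarrow> real \<Rightarrow> real \<Rightarrow> 'n minkowski" where
  "null_point \<theta> ta t' = (((ta - t') / 2) *\<^sub>R \<theta>, (ta + t') / 2)"

text \<open>The values \<open>t'\<close> at which the curve cut out on \<open>S\<close> by the half-plane of \<open>\<theta>\<close> has second
  coordinate \<open>ta\<close>.\<close>

definition slice :: "'n::finite minkowski set \<Rightarrow> real ^ 'n \<Rightarrow> real \<Rightarrow> real set" where
  "slice S \<theta> ta = {t'. t' < ta \<and> null_point \<theta> ta t' \<in> S}"

text \<open>The function \<open>f\<^sub>\<theta>\<close>. The coordinate \<open>ta\<close> may be bounded above along the curve, as for the graph
  of \<open>- sqrt (1 + \<bar>x\<bar>\<^sup>2)\<close>; in that case \<open>t'\<close> tends to \<open>-\<infinity>\<close> along it, so \<open>f\<^sub>\<theta>\<close> is extended by the value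
  \<open>-\<infinity>\<close> where the curve does not reach \<open>ta\<close>.\<close>

definition slice_fun :: "'n::finite minkowski set \<Rightarrow> real ^ 'n \<Rightarrow> real \<Rightarrow> ereal" where
  "slice_fun S \<theta> ta =
     (if slice S \<theta> ta = {} then -\<infinity> else ereal (THE t'. t' \<in> slice S \<theta> ta))"

definition cut_fun :: "'n::finite minkowski set \<Rightarrow> real ^ 'n \<Rightarrow> ereal" where
  "cut_fun S \<theta> = Lim at_top (slice_fun S \<theta>)"

definition asymptotic_cut :: "'n::finite minkowski set \<Rightarrow> ((real ^ 'n) \<times> ereal) set" where
  "asymptotic_cut S = {(\<theta>, cut_fun S \<theta>) | \<theta>. \<theta> \<in> sphere 0 1}"

text \<open>The conditions making \<open>slice_fun\<close> and \<open>cut_fun\<close> meaningful at \<open>\<theta>\<close>: for large \<open>ta\<close> the curve is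
  the graph of a decreasing function, which has a limit.\<close>

definition cut_well_defined :: "'n::finite minkowski set \<Rightarrow> real ^ 'n \<Rightarrow> bool" where
  "cut_well_defined S \<theta> \<longleftrightarrow>
     (\<exists>T. (\<forall>ta>T. \<forall>s\<in>slice S \<theta> ta. \<forall>t\<in>slice S \<theta> ta. s = t) \<and>
          antimono_on {T<..} (slice_fun S \<theta>)) \<and>
     (slice_fun S \<theta> \<longlongrightarrow> cut_fun S \<theta>) at_top"

end

theory Submission
  imports Defs
begin

text \<open>The causal character of the hypersurface enters only through one inequality: the defining
  function \<open>u\<close> satisfies \<open>\<bar>u x - u y\<bar> < norm (x - y)\<close> for \<open>x \<noteq> y\<close>. No regularity of \<open>u\<close> is given a
  priori, but the time axis is not tangent to the hypersurface, so \<open>u\<close> is locally the implicit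
  function of a defining function; hence \<open>u\<close> is differentiable, its derivative has norm less
  than 1, and the mean value theorem applies (\<open>spacelike_graph_contracting\<close>).

  Fix a unit vector \<open>\<theta>\<close>. The curve over the ray of \<open>\<theta>\<close> is parametrised by the radius \<open>r\<close>, with
  \<open>t\<^sub>a = u (r *\<^sub>R \<theta>) + r\<close> strictly increasing and \<open>t' = u (r *\<^sub>R \<theta>) - r\<close> strictly decreasing in \<open>r\<close>.
  So \<open>t'\<close> is a decreasing function of \<open>t\<^sub>a\<close>, and its limit is the infimum of \<open>u (r *\<^sub>R \<theta>) - r\<close> over
  \<open>r > 0\<close>; if \<open>t\<^sub>a\<close> stays bounded along the curve, then \<open>t' = t\<^sub>a - 2 * r\<close> is unbounded below and both
  sides are \<open>-\<infinity>\<close>. It remains to see that the supremum defining the null support function may be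
  taken along the ray alone. This is the fact that \<open>r - norm (r *\<^sub>R \<theta> - y)\<close> tends to \<open>\<theta> \<bullet> y\<close>: the past
  light cones of the points of a null line exhaust a null half-space
  (\<open>null_support_approx_on_ray\<close>).\<close>

section \<open>Spacelike graphs are strictly contracting\<close>

text \<open>Along the vertical line through a point of the graph the defining function changes sign, and
  it still does so along nearby vertical lines. The resulting zeros lie on the graph, so they are
  values of \<open>u\<close>; this bounds the oscillation of \<open>u\<close> without any regularity assumption.\<close>

lemma graph_continuous:
  fixes u :: "real ^ 'n::finite \<Rightarrow> real"
  assumes ldf: "local_defining_function (graph_of u) (a, u a) U F"
    and D: "(F has_derivative D) (at (a, u a))" and c: "D (0, 1) \<noteq> 0"
  shows "isCont u a"
proof -
  \<comment> \<open>The constant factor makes the derivative along the vertical line positive.\<close>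
  define G where "G z = D (0, 1) * F z" for z
  have U: "open U" "(a, u a) \<in> U" and S: "graph_of u \<inter> U = {z \<in> U. F z = 0}"
    and sm: "smooth_on F U"
    using ldf by (auto simp: local_defining_function_def)
  have "continuous_on U F"
    using sm unfolding smooth_on_def by (metis Ck_on.simps(1))
  then have contG: "continuous_on U G"
    unfolding G_def by (intro continuous_intros)
  have G0: "G (a, u a) = 0"
    using S U by (auto simp: G_def graph_of_def)
  have lin: "linear D" using D has_derivative_linear by blast
  have "((\<lambda>t. F (a, t)) has_derivative (\<lambda>s. D (0, s))) (at (u a))"
    by (rule has_derivative_compose[of "\<lambda>t. (a, t)" "\<lambda>s. (0, s)", OF _ D])
      (intro has_derivative_Pair derivative_intros)
  moreover have "(\<lambda>s. D (0, s)) = (*) (D (0, 1))"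
  proof
    fix s show "D (0, s) = D (0, 1) * s"
      using linear_scale[OF lin, of s "(0, 1)"] by simp
  qed
  ultimately have "((\<lambda>t. F (a, t)) has_real_derivative D (0, 1)) (at (u a))"
    by (simp only: has_field_derivative_def)
  then have dG: "((\<lambda>t. G (a, t)) has_real_derivative D (0, 1) * D (0, 1)) (at (u a))"
    unfolding G_def by (rule DERIV_cmult)
  have pos: "0 < D (0, 1) * D (0, 1)" using c by (simp add: zero_less_mult_iff) linarith
  obtain d1 where d1: "d1 > 0" "\<And>h. \<lbrakk>0 < h; h < d1\<rbrakk> \<Longrightarrow> G (a, u a) < G (a, u a + h)"
    using DERIV_pos_inc_right[OF dG pos] by blast
  obtain d2 where d2: "d2 > 0" "\<And>h. \<lbrakk>0 < h; h < d2\<rbrakk> \<Longrightarrow> G (a, u a - h) < G (a, u a)"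
    using DERIV_pos_inc_left[OF dG pos] by blast
  obtain A B where AB: "open A" "open B" "a \<in> A" "u a \<in> B" "A \<times> B \<subseteq> U"
    using open_prod_elim[OF U] by (metis SigmaD1 SigmaD2)
  obtain \<rho> where \<rho>: "\<rho> > 0" "cball (u a) \<rho> \<subseteq> B"
    using AB open_contains_cball by blast
  show ?thesis
    unfolding continuous_at_eps_delta
  proof (intro allI impI)
    fix e :: real assume "e > 0"
    define \<delta> where "\<delta> = min (min d1 d2) (min \<rho> e) / 2"
    have \<delta>: "0 < \<delta>" "\<delta> < d1" "\<delta> < d2" "\<delta> < \<rho>" "\<delta> < e"
      using \<open>e > 0\<close> d1(1) d2(1) \<rho>(1) by (auto simp: \<delta>_def)
    have IB: "t \<in> B" if "u a - \<delta> \<le> t" "t \<le> u a + \<delta>" for t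
      using that \<rho>(2) \<delta> by (auto simp: dist_real_def subset_iff)
    have AxU: "(x, t) \<in> U" if "x \<in> A" "u a - \<delta> \<le> t" "t \<le> u a + \<delta>" for x t
      using that IB AB(5) by auto
    have ch: "continuous_on A (\<lambda>x. G (x, t))" if "u a - \<delta> \<le> t" "t \<le> u a + \<delta>" for t
      by (rule continuous_on_compose2[OF contG]) (use that AxU in \<open>auto intro!: continuous_intros\<close>)
    define V where "V = (A \<inter> (\<lambda>x. G (x, u a + \<delta>)) -` {0<..}) \<inter> (A \<inter> (\<lambda>x. G (x, u a - \<delta>)) -` {..<0})"
    have "open V"
      unfolding V_def using AB(1) \<delta>
      by (intro open_Int continuous_open_preimage ch) auto
    moreover have "a \<in> V"
      using d1(2)[of \<delta>] d2(2)[of \<delta>] \<delta> AB(3) G0 by (auto simp: V_def)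
    ultimately obtain d where d: "d > 0" "ball a d \<subseteq> V"
      using open_contains_ball by blast
    have "dist (u x) (u a) < e" if "dist x a < d" for x
    proof -
      have x: "x \<in> A" "G (x, u a + \<delta>) > 0" "G (x, u a - \<delta>) < 0"
        using that d(2) by (auto simp: V_def dist_commute subset_iff)
      have "continuous_on {u a - \<delta>..u a + \<delta>} (\<lambda>t. G (x, t))"
        by (rule continuous_on_compose2[OF contG]) (use x AxU in \<open>auto intro!: continuous_intros\<close>)
      then obtain t where t: "u a - \<delta> \<le> t" "t \<le> u a + \<delta>" "G (x, t) = 0"
        using IVT'[of "\<lambda>t. G (x, t)" "u a - \<delta>" 0 "u a + \<delta>"] x \<delta> by auto
      have "(x, t) \<in> graph_of u"
        using S t AxU[OF x(1)] c by (auto simp: G_def)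
      then have "u x = t" by (auto simp: graph_of_def)
      then show ?thesis using t \<delta> by (auto simp: dist_real_def)
    qed
    then show "\<exists>d>0. \<forall>x. dist x a < d \<longrightarrow> dist (u x) (u a) < e" using d(1) by blast
  qed
qed

text \<open>Implicit differentiation. Continuity of \<open>u\<close> allows the expansion of \<open>F\<close> at increments \<open>(h, k)\<close>
  along the graph; as \<open>D (0, 1) \<noteq> 0\<close>, it first gives \<open>\<bar>k\<bar> \<le> M * norm h\<close>, and then the error term
  becomes small relative to \<open>norm h\<close> alone.\<close>

lemma implicit_function_has_derivative:
  fixes u :: "'a::real_normed_vector \<Rightarrow> real"
  assumes D: "(F has_derivative D) (at (a, u a))" and c: "D (0, 1) \<noteq> 0"
    and cont: "isCont u a" and F0: "\<forall>\<^sub>F x in nhds a. F (x, u x) = (0::real)"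
  shows "(u has_derivative (\<lambda>h. - D (h, 0) / D (0, 1))) (at a)"
proof -
  define c where "c = D (0, 1)"
  have c0: "\<bar>c\<bar> > 0" using assms(2) by (simp add: c_def)
  have bl: "bounded_linear D" using D has_derivative_bounded_linear by blast
  obtain K where K: "K > 0" "\<And>z. \<bar>D z\<bar> \<le> norm z * K"
    using bounded_linear.pos_bounded[OF bl] by auto
  have split: "D (h, k) = D (h, 0) + k * c" for h k
    using linear_add[OF bounded_linear.linear[OF bl], of "(h, 0)" "(0, k)"]
      linear_scale[OF bounded_linear.linear[OF bl], of k "(0, 1)"] by (simp add: c_def)
  \<comment> \<open>With error constant \<open>\<bar>c\<bar> / 2\<close>, half of \<open>\<bar>c\<bar> * \<bar>k\<bar>\<close> is absorbed on the left; this is the Lipschitz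
    constant that results.\<close>
  define M where "M = 2 * K / \<bar>c\<bar> + 1"
  have M: "M > 0" using K c0 by (simp add: M_def add_pos_pos)
  have bl': "bounded_linear (\<lambda>h. - D (h, 0) / c)"
    by (intro bounded_linear_divide[THEN bounded_linear_compose] bounded_linear_minus
          bounded_linear_compose[OF bl] bounded_linear_Pair bounded_linear_ident bounded_linear_zero)
  show ?thesis
    unfolding has_derivative_at_alt c_def[symmetric]
  proof (intro conjI bl' allI impI)
    fix \<epsilon> :: real assume "\<epsilon> > 0"
    define e where "e = min (\<bar>c\<bar> / 2) (\<epsilon> * \<bar>c\<bar> / (1 + M))"
    have e: "e > 0" "e \<le> \<bar>c\<bar> / 2" "e \<le> \<epsilon> * \<bar>c\<bar> / (1 + M)"
      unfolding e_def using \<open>\<epsilon> > 0\<close> c0 M by (simp, linarith, linarith)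
    obtain d where d: "d > 0" "\<And>z. norm (z - (a, u a)) < d \<Longrightarrow>
        norm (F z - F (a, u a) - D (z - (a, u a))) \<le> e * norm (z - (a, u a))"
      using D e(1) unfolding has_derivative_at_alt by blast
    have "isCont (\<lambda>x. (x, u x)) a" using cont by (intro continuous_intros)
    then obtain d' where d': "d' > 0" "\<And>x. dist x a < d' \<Longrightarrow> dist (x, u x) (a, u a) < d"
      using d(1) unfolding continuous_at_eps_delta by blast
    obtain d'' where d'': "d'' > 0" "\<And>x. dist x a < d'' \<Longrightarrow> F (x, u x) = 0"
      using F0 unfolding eventually_nhds_metric by blast
    have "norm (u x - u a - - D (x - a, 0) / c) \<le> \<epsilon> * norm (x - a)"
      if x: "norm (x - a) < min d' d''" for x
    proof -
      define h k where "h = x - a" and "k = u x - u a"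
      have "norm ((x, u x) - (a, u a)) < d" "F (x, u x) = 0" "F (a, u a) = 0"
        using d'(2)[of x] d''(2)[of x] d''(2)[of a] d''(1) x by (auto simp: dist_norm)
      then have "\<bar>D (h, k)\<bar> \<le> e * norm (h, k)"
        using d(2)[of "(x, u x)"] by (simp add: h_def k_def)
      also have "\<dots> \<le> e * (norm h + \<bar>k\<bar>)"
        using norm_Pair_le[of h k] e(1) by simp
      finally have est: "\<bar>D (h, 0) + k * c\<bar> \<le> e * (norm h + \<bar>k\<bar>)" unfolding split[of h k] .
      have "2 * (e * (norm h + \<bar>k\<bar>)) \<le> \<bar>c\<bar> * (norm h + \<bar>k\<bar>)"
        using mult_right_mono[of "2 * e" "\<bar>c\<bar>" "norm h + \<bar>k\<bar>"] e(2) by (simp add: mult.assoc)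
      moreover have "\<bar>k * c\<bar> \<le> \<bar>D (h, 0) + k * c\<bar> + \<bar>D (h, 0)\<bar>" by arith
      ultimately have "2 * \<bar>k * c\<bar> \<le> \<bar>c\<bar> * (norm h + \<bar>k\<bar>) + 2 * (norm h * K)"
        using est K(2)[of "(h, 0)"] by simp
      then have "\<bar>k\<bar> * \<bar>c\<bar> \<le> 2 * (norm h * K) + norm h * \<bar>c\<bar>"
        by (simp add: abs_mult distrib_left mult.commute)
      also have "\<dots> = (M * norm h) * \<bar>c\<bar>"
        using c0 by (simp add: M_def field_simps)
      finally have "\<bar>k\<bar> * \<bar>c\<bar> \<le> (M * norm h) * \<bar>c\<bar>" .
      then have "\<bar>k\<bar> \<le> M * norm h" using c0 by simp
      then have "e * (norm h + \<bar>k\<bar>) \<le> (\<epsilon> * \<bar>c\<bar> / (1 + M)) * ((1 + M) * norm h)"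
        using e \<open>\<epsilon> > 0\<close> c0 M by (intro mult_mono) (auto simp: algebra_simps)
      also have "\<dots> = \<epsilon> * norm h * \<bar>c\<bar>" using M by simp
      finally have "\<bar>D (h, 0) + k * c\<bar> \<le> \<epsilon> * norm h * \<bar>c\<bar>" using est by linarith
      then have "\<bar>D (h, 0) + k * c\<bar> / \<bar>c\<bar> \<le> \<epsilon> * norm h" using c0 by (simp add: divide_le_eq)
      moreover have "k - - D (h, 0) / c = (D (h, 0) + k * c) / c" using c0 by (simp add: field_simps)
      ultimately show ?thesis by (simp add: h_def k_def abs_divide)
    qed
    then show "\<exists>d>0. \<forall>y. norm (y - a) < d \<longrightarrow>
        norm (u y - u a - - D (y - a, 0) / c) \<le> \<epsilon> * norm (y - a)"
      using d'(1) d''(1) by (intro exI[of _ "min d' d''"]) auto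
  qed
qed

text \<open>Vectors in the kernel of the derivative of a defining function are tangent, hence spacelike.
  For the time direction \<open>(0, 1)\<close> this gives the nonvanishing that the implicit function needs; for
  the vectors \<open>(h, u' h)\<close> it is the bound on the derivative.\<close>

lemma spacelike_graph_has_derivative:
  fixes u :: "real ^ 'n::finite \<Rightarrow> real"
  assumes S: "spacelike_hypersurface (graph_of u)"
  obtains u' where "(u has_derivative u') (at a)" "\<And>h. h \<noteq> 0 \<Longrightarrow> \<bar>u' h\<bar> < norm h"
proof -
  let ?p = "(a, u a)"
  have p: "?p \<in> graph_of u" by (simp add: graph_of_def)
  obtain U F where ldf: "local_defining_function (graph_of u) ?p U F"
    using S p by (auto simp: spacelike_hypersurface_def smooth_hypersurface_def)
  define D where "D = frechet_derivative F (at ?p)"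
  have U: "open U" "?p \<in> U" and eq: "graph_of u \<inter> U = {z \<in> U. F z = 0}"
    and sm: "smooth_on F U"
    using ldf by (auto simp: local_defining_function_def)
  have "Ck_on (Suc 0) F U" using sm by (simp only: smooth_on_def)
  then have D: "(F has_derivative D) (at ?p)"
    using U by (auto simp: D_def frechet_derivative_works[symmetric])
  have ker: "mink_inner v v > 0" if "D v = 0" "v \<noteq> 0" for v
  proof -
    have "v \<in> tangent_space (graph_of u) ?p"
      using ldf that by (auto simp: tangent_space_def D_def)
    then show ?thesis using S p that(2) unfolding spacelike_hypersurface_def by blast
  qed
  have c: "D (0, 1) \<noteq> 0" using ker[of "(0, 1)"] by (auto simp: mink_inner_def zero_prod_def)
  have cont: "isCont u a" by (rule graph_continuous[OF ldf D c])
  have "isCont (\<lambda>x. (x, u x)) a" using cont by (intro continuous_intros)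
  then have "((\<lambda>x. (x, u x)) \<longlongrightarrow> ?p) (nhds a)"
    using tendsto_at_iff_tendsto_nhds isCont_def by fastforce
  then have "\<forall>\<^sub>F x in nhds a. (x, u x) \<in> U" using U by (rule topological_tendstoD)
  then have "\<forall>\<^sub>F x in nhds a. F (x, u x) = 0"
  proof eventually_elim
    case (elim x)
    then show ?case using eq by (auto simp: graph_of_def)
  qed
  from implicit_function_has_derivative[OF D c cont this]
  have u': "(u has_derivative (\<lambda>h. - D (h, 0) / D (0, 1))) (at a)" .
  have "\<bar>- D (h, 0) / D (0, 1)\<bar> < norm h" if "h \<noteq> 0" for h
  proof -
    define k where "k = - D (h, 0) / D (0, 1)"
    have lin: "linear D" using D has_derivative_linear by blast
    have "D (h, k) = D (h, 0) + k * D (0, 1)"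
      using linear_add[OF lin, of "(h, 0)" "(0, k)"] linear_scale[OF lin, of k "(0, 1)"] by simp
    also have "\<dots> = 0" using c by (simp add: k_def)
    finally have "mink_inner (h, k) (h, k) > 0" using ker that by (auto simp: zero_prod_def)
    then have "k\<^sup>2 < (norm h)\<^sup>2" by (simp add: mink_inner_def power2_eq_square
          power2_norm_eq_inner[symmetric])
    then show ?thesis by (metis k_def power2_less_imp_less power2_abs norm_ge_zero)
  qed
  then show ?thesis using u' that by blast
qed

lemma spacelike_graph_contracting:
  fixes u :: "real ^ 'n::finite \<Rightarrow> real"
  assumes S: "spacelike_hypersurface (graph_of u)" and "x \<noteq> y"
  shows "\<bar>u x - u y\<bar> < norm (x - y)"
proof -
  define w where "w s = u (y + s *\<^sub>R (x - y))" for s :: real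
  obtain u' where u': "\<And>a. (u has_derivative u' a) (at a)" "\<And>a h. h \<noteq> 0 \<Longrightarrow> \<bar>u' a h\<bar> < norm h"
  proof -
    have "\<exists>u'. (u has_derivative u') (at a) \<and> (\<forall>h. h \<noteq> 0 \<longrightarrow> \<bar>u' h\<bar> < norm h)" for a
      by (rule spacelike_graph_has_derivative[OF S, of a]) blast
    then have "\<forall>a. \<exists>u'. (u has_derivative u') (at a) \<and> (\<forall>h. h \<noteq> 0 \<longrightarrow> \<bar>u' h\<bar> < norm h)"
      by (rule allI)
    from choice[OF this] show ?thesis using that by blast
  qed
  have dw: "(w has_derivative (\<lambda>t. u' (y + s *\<^sub>R (x - y)) (t *\<^sub>R (x - y)))) (at s)" for s
    unfolding w_def
    by (rule has_derivative_compose[OF _ u'(1)]) (auto intro!: derivative_eq_intros)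
  have "continuous_on {0..1} w"
    by (rule has_derivative_continuous_on[OF has_derivative_at_withinI[OF dw]])
  then obtain s where "w 1 - w 0 = u' (y + s *\<^sub>R (x - y)) ((1 - 0) *\<^sub>R (x - y))"
    using mvt[of 0 1 w "\<lambda>s t. u' (y + s *\<^sub>R (x - y)) (t *\<^sub>R (x - y))"] dw by force
  then show ?thesis using u'(2)[of "x - y"] assms(2) by (simp add: w_def)
qed

section \<open>The null support function along a ray\<close>

lemma tendsto_minus_norm_ray:
  fixes \<theta> y :: "'a::real_inner"
  assumes "norm \<theta> = 1"
  shows "((\<lambda>r. r - norm (r *\<^sub>R \<theta> - y)) \<longlongrightarrow> \<theta> \<bullet> y) at_top"
proof -
  have th: "\<theta> \<bullet> \<theta> = 1" using assms by (simp add: norm_eq_1)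
  have inv: "((\<lambda>r::real. inverse r) \<longlongrightarrow> 0) at_top" by (rule tendsto_inverse_0_at_top[OF filterlim_ident])
  have "((\<lambda>r. (2 * (\<theta> \<bullet> y) - inverse r * (norm y)\<^sup>2) / (1 + norm (\<theta> - inverse r *\<^sub>R y)))
      \<longlongrightarrow> (2 * (\<theta> \<bullet> y) - 0 * (norm y)\<^sup>2) / (1 + norm (\<theta> - 0 *\<^sub>R y))) at_top"
    using assms by (intro tendsto_intros inv) auto
  then have lim: "((\<lambda>r. (2 * (\<theta> \<bullet> y) - inverse r * (norm y)\<^sup>2) / (1 + norm (\<theta> - inverse r *\<^sub>R y)))
      \<longlongrightarrow> \<theta> \<bullet> y) at_top"
    using assms by simp
  have "(2 * (\<theta> \<bullet> y) - inverse r * (norm y)\<^sup>2) / (1 + norm (\<theta> - inverse r *\<^sub>R y))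
      = r - norm (r *\<^sub>R \<theta> - y)" if "r > 0" for r
  proof -
    define q where "q = norm (\<theta> - inverse r *\<^sub>R y)"
    have "r *\<^sub>R \<theta> - y = r *\<^sub>R (\<theta> - inverse r *\<^sub>R y)" using that by (simp add: algebra_simps)
    then have n: "norm (r *\<^sub>R \<theta> - y) = r * q" using that by (simp add: q_def)
    have q2: "q\<^sup>2 = 1 - 2 * inverse r * (\<theta> \<bullet> y) + inverse r * inverse r * (norm y)\<^sup>2"
      unfolding q_def power2_norm_eq_inner
      by (simp add: inner_diff_left inner_diff_right th inner_commute algebra_simps)
    have "r * (1 - q\<^sup>2) = 2 * (\<theta> \<bullet> y) - inverse r * (norm y)\<^sup>2"
      unfolding q2 using that by (simp add: field_simps)
    then have "2 * (\<theta> \<bullet> y) - inverse r * (norm y)\<^sup>2 = (r - r * q) * (1 + q)"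
      by (simp add: algebra_simps power2_eq_square)
    moreover have "1 + q > 0" unfolding q_def by (intro add_pos_nonneg) auto
    ultimately show ?thesis using n by (simp add: q_def[symmetric])
  qed
  then show ?thesis
    by (intro Lim_transform_eventually[OF lim] eventually_mono[OF eventually_gt_at_top[of 0]]) auto
qed

text \<open>Since \<open>u (r *\<^sub>R \<theta>) \<le> u y + norm (r *\<^sub>R \<theta> - y)\<close>, the value at \<open>y\<close> of the expression whose supremum
  is the null support function is almost attained far out on the ray.\<close>

lemma null_support_approx_on_ray:
  fixes u :: "real ^ 'n::finite \<Rightarrow> real"
  assumes lip: "\<And>x y. \<bar>u x - u y\<bar> \<le> norm (x - y)" and \<theta>: "norm \<theta> = 1"
    and b: "ereal b < null_support u \<theta>"
  obtains r where "r > 0" "b < r - u (r *\<^sub>R \<theta>)"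
proof -
  obtain y where y: "b < \<theta> \<bullet> y - u y"
    using b by (auto simp: null_support_def less_SUP_iff)
  then have "\<forall>\<^sub>F r in at_top. b + u y < r - norm (r *\<^sub>R \<theta> - y)"
    by (intro order_tendstoD(1)[OF tendsto_minus_norm_ray[OF \<theta>]]) linarith
  then have "\<forall>\<^sub>F r in at_top. b + u y < r - norm (r *\<^sub>R \<theta> - y) \<and> r > 0"
    by (intro eventually_conj eventually_gt_at_top)
  then obtain r where "b + u y < r - norm (r *\<^sub>R \<theta> - y)" "r > 0"
    using eventually_happens'[OF trivial_limit_at_top_linorder] by blast
  then show ?thesis using that[of r] lip[of "r *\<^sub>R \<theta>" y] by linarith
qed

lemma null_support_ray_le:
  fixes u :: "real ^ 'n::finite \<Rightarrow> real"
  assumes "norm \<theta> = 1"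
  shows "ereal (r - u (r *\<^sub>R \<theta>)) \<le> null_support u \<theta>"
proof -
  have "ereal (\<theta> \<bullet> (r *\<^sub>R \<theta>) - u (r *\<^sub>R \<theta>)) \<le> null_support u \<theta>"
    unfolding null_support_def by (rule SUP_upper) simp
  then show ?thesis using assms by (simp add: norm_eq_1)
qed

section \<open>The slices of a strictly contracting graph\<close>

lemma slice_graph_iff:
  "t \<in> slice (graph_of u) \<theta> ta \<longleftrightarrow>
    (\<exists>r>0. u (r *\<^sub>R \<theta>) + r = ta \<and> u (r *\<^sub>R \<theta>) - r = t)"
proof
  assume "t \<in> slice (graph_of u) \<theta> ta"
  then show "\<exists>r>0. u (r *\<^sub>R \<theta>) + r = ta \<and> u (r *\<^sub>R \<theta>) - r = t"
    by (intro exI[of _ "(ta - t) / 2"]) (auto simp: slice_def graph_of_def null_point_def field_simps)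
next
  assume "\<exists>r>0. u (r *\<^sub>R \<theta>) + r = ta \<and> u (r *\<^sub>R \<theta>) - r = t"
  then obtain r where "r > 0" "u (r *\<^sub>R \<theta>) + r = ta" "u (r *\<^sub>R \<theta>) - r = t" by blast
  moreover from this have "(ta - t) / 2 = r" "(ta + t) / 2 = u (r *\<^sub>R \<theta>)" by auto
  ultimately show "t \<in> slice (graph_of u) \<theta> ta"
    by (auto simp: slice_def graph_of_def null_point_def)
qed

context
  fixes u :: "real ^ 'n::finite \<Rightarrow> real" and \<theta> :: "real ^ 'n"
  assumes contr: "\<And>x y. x \<noteq> y \<Longrightarrow> \<bar>u x - u y\<bar> < norm (x - y)" and \<theta>: "norm \<theta> = 1"
begin

lemma contracting_le: "\<bar>u x - u y\<bar> \<le> norm (x - y)"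
  using contr[of x y] by (cases "x = y") auto

lemma ray_contracting:
  assumes "r < s"
  shows "\<bar>u (s *\<^sub>R \<theta>) - u (r *\<^sub>R \<theta>)\<bar> < s - r"
proof -
  have "norm (s *\<^sub>R \<theta> - r *\<^sub>R \<theta>) = s - r"
    using assms \<theta> by (simp flip: scaleR_diff_left)
  moreover have "s *\<^sub>R \<theta> \<noteq> r *\<^sub>R \<theta>" using assms \<theta> by auto
  ultimately show ?thesis using contr by metis
qed

lemma advanced_time_strict_mono: "strict_mono (\<lambda>r. u (r *\<^sub>R \<theta>) + r)"
proof (rule strict_monoI)
  fix r s :: real assume "r < s"
  from ray_contracting[OF this] show "u (r *\<^sub>R \<theta>) + r < u (s *\<^sub>R \<theta>) + s" by linarith
qed

lemma slice_unique:
  assumes "s \<in> slice (graph_of u) \<theta> ta" "t \<in> slice (graph_of u) \<theta> ta"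
  shows "s = t"
  using assms strict_mono_eq[OF advanced_time_strict_mono] by (auto simp: slice_graph_iff)

lemma slice_fun_ray:
  assumes "r > 0"
  shows "slice_fun (graph_of u) \<theta> (u (r *\<^sub>R \<theta>) + r) = ereal (u (r *\<^sub>R \<theta>) - r)"
proof -
  have "u (r *\<^sub>R \<theta>) - r \<in> slice (graph_of u) \<theta> (u (r *\<^sub>R \<theta>) + r)"
    using assms by (auto simp: slice_graph_iff)
  then show ?thesis
    using slice_unique by (auto simp: slice_fun_def intro!: the_equality)
qed

lemma slice_fun_cases [case_names empty ray]:
  assumes "slice (graph_of u) \<theta> ta = {} \<Longrightarrow> slice_fun (graph_of u) \<theta> ta = -\<infinity> \<Longrightarrow> P"
    and "\<And>r. r > 0 \<Longrightarrow> ta = u (r *\<^sub>R \<theta>) + r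
      \<Longrightarrow> slice_fun (graph_of u) \<theta> ta = ereal (u (r *\<^sub>R \<theta>) - r) \<Longrightarrow> P"
  shows P
proof (cases "slice (graph_of u) \<theta> ta = {}")
  case True
  then show ?thesis using assms(1) by (simp add: slice_fun_def)
next
  case False
  then show ?thesis using assms(2) slice_fun_ray by (fastforce simp: slice_graph_iff)
qed

text \<open>The values of \<open>t\<^sub>a\<close> along the curve form an interval that starts at the value \<open>u 0\<close> on the
  time axis; this value serves as the threshold beyond which the slices are considered.\<close>

lemma slice_nonempty:
  assumes "u 0 < ta" "ta \<le> u (R *\<^sub>R \<theta>) + R" "R > 0"
  shows "slice (graph_of u) \<theta> ta \<noteq> {}"
proof -
  have "1-lipschitz_on UNIV u"
    using contracting_le by (auto simp: lipschitz_on_def dist_real_def dist_norm)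
  then have "continuous_on UNIV u" by (rule lipschitz_on_continuous_on)
  then have "continuous_on {0..R} (\<lambda>r. u (r *\<^sub>R \<theta>) + r)"
    by (auto intro!: continuous_intros intro: continuous_on_compose2)
  then obtain r where r: "0 \<le> r" "r \<le> R" "u (r *\<^sub>R \<theta>) + r = ta"
    using IVT'[of "\<lambda>r. u (r *\<^sub>R \<theta>) + r" 0 ta R] assms by auto
  moreover have "r \<noteq> 0" using r assms by auto
  ultimately show ?thesis using slice_graph_iff[of "u (r *\<^sub>R \<theta>) - r" u \<theta> ta] by force
qed

lemma slice_fun_antimono: "antimono_on {u 0<..} (slice_fun (graph_of u) \<theta>)"
proof (rule monotone_onI)
  fix ta tb assume ab: "ta \<in> {u 0<..}" "tb \<in> {u 0<..}" "ta \<le> tb"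
  show "slice_fun (graph_of u) \<theta> tb \<le> slice_fun (graph_of u) \<theta> ta"
  proof (cases rule: slice_fun_cases[of tb])
    case empty
    then show ?thesis by simp
  next
    case b: (ray s)
    show ?thesis
    proof (cases rule: slice_fun_cases[of ta])
      case empty
      then show ?thesis using slice_nonempty[of ta s] ab b by auto
    next
      case a: (ray r)
      have "r \<le> s"
        using strict_mono_less_eq[OF advanced_time_strict_mono, of r s] a(2) b(2) ab(3) by simp
      then have "u (s *\<^sub>R \<theta>) - s \<le> u (r *\<^sub>R \<theta>) - r"
        using ray_contracting[of r s] by (cases "r = s") auto
      then show ?thesis using a(3) b(3) by simp
    qed
  qed
qed

text \<open>Where the curve does not reach \<open>ta\<close>, the expression \<open>u (r *\<^sub>R \<theta>) + r\<close> is bounded by \<open>ta\<close>, so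
  \<open>r - u (r *\<^sub>R \<theta>) \<ge> 2 * r - ta\<close> is unbounded above.\<close>

lemma slice_fun_ge:
  assumes "u 0 < ta"
  shows "- null_support u \<theta> \<le> slice_fun (graph_of u) \<theta> ta"
proof (cases rule: slice_fun_cases[of ta])
  case empty
  have "ereal b \<le> null_support u \<theta>" for b
  proof -
    define r where "r = \<bar>b\<bar> + \<bar>ta\<bar> + 1"
    have "u (r *\<^sub>R \<theta>) + r < ta"
      using slice_nonempty[OF assms, of r] empty(1) by (force simp: r_def)
    then have "b \<le> r - u (r *\<^sub>R \<theta>)" by (simp add: r_def)
    then show ?thesis using null_support_ray_le[OF \<theta>, of r u] by (meson ereal_less_eq(3) order_trans)
  qed
  then have "null_support u \<theta> = \<infinity>" by (intro ereal_top) auto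
  then show ?thesis by simp
next
  case (ray r)
  have "- null_support u \<theta> \<le> - ereal (r - u (r *\<^sub>R \<theta>))"
    using null_support_ray_le[OF \<theta>, of r u] by (simp only: ereal_minus_le_minus)
  then show ?thesis using ray(3) by simp
qed

lemma slice_fun_tendsto:
  "(slice_fun (graph_of u) \<theta> \<longlongrightarrow> - null_support u \<theta>) at_top"
proof (rule order_tendstoI)
  fix b assume "b < - null_support u \<theta>"
  then show "\<forall>\<^sub>F ta in at_top. b < slice_fun (graph_of u) \<theta> ta"
    by (intro eventually_mono[OF eventually_gt_at_top[of "u 0"]]) (meson less_le_trans slice_fun_ge)
next
  fix b assume b: "- null_support u \<theta> < b"
  then obtain c where c: "- null_support u \<theta> < ereal c" "ereal c < b"
    using ereal_dense2 by blast
  then have "ereal (- c) < null_support u \<theta>"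
    using ereal_uminus_less_reorder[of "null_support u \<theta>" "ereal c"] by simp
  then obtain r where r: "r > 0" "- c < r - u (r *\<^sub>R \<theta>)"
    using null_support_approx_on_ray[OF contracting_le \<theta>] by blast
  let ?T = "u (r *\<^sub>R \<theta>) + r"
  have T: "u 0 < ?T"
    using strict_monoD[OF advanced_time_strict_mono r(1)] by simp
  have "slice_fun (graph_of u) \<theta> ta < b" if "ta \<ge> ?T" for ta
  proof -
    have "slice_fun (graph_of u) \<theta> ta \<le> slice_fun (graph_of u) \<theta> ?T"
      using monotone_onD[OF slice_fun_antimono] T that by auto
    also have "\<dots> < ereal c" using slice_fun_ray[OF r(1)] r(2) by simp
    finally show ?thesis using c(2) by order
  qed
  then show "\<forall>\<^sub>F ta in at_top. slice_fun (graph_of u) \<theta> ta < b"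
    by (auto simp: eventually_at_top_linorder)
qed

lemma cut_fun_contracting_graph: "cut_fun (graph_of u) \<theta> = - null_support u \<theta>"
  unfolding cut_fun_def by (rule tendsto_Lim[OF trivial_limit_at_top_linorder slice_fun_tendsto])

lemma cut_well_defined_contracting_graph: "cut_well_defined (graph_of u) \<theta>"
  unfolding cut_well_defined_def cut_fun_contracting_graph
  using slice_unique slice_fun_antimono slice_fun_tendsto by blast

end

section \<open>The asymptotic cut\<close>

theorem proposition1p19:
  fixes \<Sigma> :: "((real ^ 'n::finite) \<times> real) set" and u :: "real ^ 'n \<Rightarrow> real"
  assumes "spacelike_hypersurface \<Sigma>"
    and "\<Sigma> = graph_of u"
  shows "(\<forall>\<theta> \<in> sphere 0 1. cut_well_defined \<Sigma> \<theta> \<and> cut_fun \<Sigma> \<theta> = - null_support u \<theta>) \<and>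
         asymptotic_cut \<Sigma> = {(\<theta>, - null_support u \<theta>) | \<theta>. \<theta> \<in> sphere 0 1}"
proof -
  have contr: "\<And>x y. x \<noteq> y \<Longrightarrow> \<bar>u x - u y\<bar> < norm (x - y)"
    using spacelike_graph_contracting assms by blast
  have "cut_well_defined \<Sigma> \<theta> \<and> cut_fun \<Sigma> \<theta> = - null_support u \<theta>"
    if "\<theta> \<in> sphere 0 1" for \<theta>
    using cut_well_defined_contracting_graph[of u \<theta>, OF contr]
      cut_fun_contracting_graph[of u \<theta>, OF contr] assms(2) that by simp
  then show ?thesis by (auto simp: asymptotic_cut_def)
qed

end
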